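(* Let $n\ge 2$ be an integer. Then for every $z\in\mathbb{Z}_n$ there exist integers $x,y$ with $x^2+y^2\equiv z\pmod n$ (where $x^2\equiv 0$ or $y^2\equiv 0\pmod n$ is allowed) if and only if the following two conditions hold: (1) $n\not\equiv 0\pmod{q^2}$ for any prime $q\equiv 3\pmod 4$ with $n\equiv 0\pmod q$; (2) $n\not\equiv 0\pmod 4$.
   Context: $\mathbb{Z}_n$ denotes the ring of integers modulo $n$. *)

theory Defs
  imports "HOL-Number_Theory.Number_Theory"
begin

end

theory Submission
  imports Defs
begin

text \<open>
  If q is a prime with q = 3 (mod 4), then -1 is not a square modulo q, so q divides a sum of two
  squares only if it divides both terms; hence q itself is not a sum of two squares modulo any
  multiple of q^2. Conversely, by the Chinese remainder theorem it suffices to treat prime powers.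
  For p = 1 (mod 4) there is a square root i of -1 modulo p^k, and z is the difference of the squares
  of (z + 1) / 2 and (z - 1) / 2. For p = 3 (mod 4) some s^2 + 1 is a nonresidue modulo p: otherwise
  the squares would be closed under adding 1 and -1 would be a square. Every nonresidue is then
  s^2 + 1 times a square.
\<close>

text \<open>Letting z range over all integers, not over the representatives in
  \<open>carrier (residue_ring n)\<close>, keeps the predicate free of a choice of residues when
  moduli are multiplied.\<close>

definition sums_of_two_squares_mod :: "int \<Rightarrow> bool" where
  "sums_of_two_squares_mod n \<longleftrightarrow> (\<forall>z. \<exists>x y :: int. [x\<^sup>2 + y\<^sup>2 = z] (mod n))"

section \<open>Quadratic residues modulo an odd prime\<close>

lemma coprime_prime_int:
  fixes p :: nat and a :: int
  assumes "prime p" "\<not> int p dvd a"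
  shows "coprime a (int p)"
  using assms by (metis coprime_commute prime_imp_coprime prime_nat_int_transfer)

text \<open>Euler's criterion at -1: for odd p the exponent (p - 1) / 2 is even exactly when p is 1
  modulo 4. The facts \<open>n0\<close> and \<open>n1\<close> keep the values 0, 1 and -1 apart
  modulo p, so the congruence determines the Legendre symbol.\<close>

lemma QuadRes_minus_one_iff:
  fixes p :: nat
  assumes p: "prime p" "2 < p"
  shows "QuadRes p (-1) \<longleftrightarrow> p mod 4 = 1"
proof -
  have n0: "\<not> [-1 = 0] (mod int p)"
    using p by (simp add: cong_0_iff)
  have n1: "\<not> [1 = -1] (mod int p)" "\<not> [-1 = 1] (mod int p)"
    using p zdvd_imp_le[of "int p" 2] by (auto simp: cong_iff_dvd_diff)
  have odd: "odd p"
    using p prime_odd_nat by blast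
  have euler: "[Legendre (-1) p = (-1) ^ ((p - 1) div 2)] (mod int p)"
    using euler_criterion[OF p] .
  show ?thesis
  proof (cases "even ((p - 1) div 2)")
    case True
    then have "p mod 4 = 1"
      using odd by presburger
    with True euler n0 n1 show ?thesis
      by (auto simp: Legendre_def split: if_splits)
  next
    case False
    then have "p mod 4 \<noteq> 1"
      using odd by presburger
    with False euler n0 n1 show ?thesis
      by (auto simp: Legendre_def split: if_splits)
  qed
qed

text \<open>By Euler's criterion a nonresidue has (p - 1) / 2-th power -1. If a, b and a * b were
  all nonresidues, then (-1) * (-1) = -1 modulo p, forcing p to divide 2.\<close>

lemma QuadRes_mult_nonresidues:
  fixes p :: nat
  assumes p: "prime p" "2 < p" and a: "\<not> QuadRes p a" and b: "\<not> QuadRes p b"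
  shows "QuadRes p (a * b)"
proof (rule ccontr)
  assume ab: "\<not> QuadRes p (a * b)"
  have nz: "\<not> [c = 0] (mod int p)" if "\<not> QuadRes p c" for c
  proof
    assume "[c = 0] (mod int p)"
    then have "[0\<^sup>2 = c] (mod int p)"
      by (simp add: cong_sym)
    with that show False
      unfolding QuadRes_def by blast
  qed
  have L: "[-1 = c ^ ((p - 1) div 2)] (mod int p)" if "\<not> QuadRes p c" for c
    using euler_criterion[OF p, of c] nz[OF that] that by (simp add: Legendre_def)
  have "[(-1) * (-1) = (a * b) ^ ((p - 1) div 2)] (mod int p)"
    unfolding power_mult_distrib by (intro cong_mult L a b)
  moreover have "[(a * b) ^ ((p - 1) div 2) = -1] (mod int p)"
    using L[OF ab] by (rule cong_sym)
  ultimately have "[(-1) * (-1) = -1] (mod int p)"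
    by (rule cong_trans)
  then have "int p dvd 2"
    by (simp add: cong_iff_dvd_diff)
  then show False
    using p zdvd_imp_le[of "int p" 2] by simp
qed

section \<open>Primes congruent to 3 modulo 4\<close>

text \<open>If x had an inverse u modulo p, then (y * u)^2 would be -1 modulo p.\<close>

lemma prime_dvd_sum_of_squares:
  fixes p :: nat and x y :: int
  assumes p: "prime p" "p mod 4 = 3" and dvd: "int p dvd x\<^sup>2 + y\<^sup>2"
  shows "int p dvd x"
proof (rule ccontr)
  assume "\<not> int p dvd x"
  then obtain u where u: "[x * u = 1] (mod int p)"
    using cong_solve_coprime_int coprime_prime_int p(1) by blast
  then have "[(x * u)\<^sup>2 = 1\<^sup>2] (mod int p)"
    by (rule cong_pow)
  then have "int p dvd (x * u)\<^sup>2 - 1"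
    by (simp add: cong_iff_dvd_diff)
  then have "int p dvd (x\<^sup>2 + y\<^sup>2) * u\<^sup>2 - ((x * u)\<^sup>2 - 1)"
    using dvd by (meson dvd_diff dvd_mult2)
  also have "\<dots> = (y * u)\<^sup>2 - (-1)"
    by (simp add: power2_eq_square algebra_simps)
  finally have "QuadRes p (-1)"
    unfolding QuadRes_def cong_iff_dvd_diff by blast
  moreover have "2 < p"
    using p(2) prime_ge_2_nat[OF p(1)] by (cases "p = 2") auto
  ultimately show False
    using QuadRes_minus_one_iff p by simp
qed

lemma exists_nonresidue_square_plus_one:
  fixes p :: nat
  assumes p: "prime p" "p mod 4 = 3"
  obtains s :: int where "\<not> QuadRes p (s\<^sup>2 + 1)"
proof -
  have "2 < p"
    using p(2) prime_ge_2_nat[OF p(1)] by (cases "p = 2") auto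
  then have neg: "\<not> QuadRes p (-1)"
    using QuadRes_minus_one_iff p by simp
  have "\<exists>s :: int. \<not> QuadRes p (s\<^sup>2 + 1)"
  proof (rule ccontr)
    assume "\<nexists>s :: int. \<not> QuadRes p (s\<^sup>2 + 1)"
    then have step: "QuadRes p (s\<^sup>2 + 1)" for s :: int
      by blast
    \<comment> \<open>Induction from the square 0 makes every natural number a square modulo p; the
      instance p - 1 represents -1.\<close>
    have all: "QuadRes p (int a)" for a
    proof (induction a)
      case 0
      have "[0\<^sup>2 = int 0] (mod int p)" by simp
      then show ?case
        unfolding QuadRes_def by blast
    next
      case (Suc a)
      then obtain y where "[y\<^sup>2 = int a] (mod int p)"
        unfolding QuadRes_def by blast
      then have y: "[y\<^sup>2 + 1 = int (Suc a)] (mod int p)"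
        by (simp add: cong_iff_dvd_diff)
      obtain w where "[w\<^sup>2 = y\<^sup>2 + 1] (mod int p)"
        using step[of y] unfolding QuadRes_def by blast
      with y show ?case
        unfolding QuadRes_def by (blast intro: cong_trans)
    qed
    have "[int (p - 1) = -1] (mod int p)"
      using \<open>2 < p\<close> by (simp add: cong_iff_dvd_diff)
    with all[of "p - 1"] neg show False
      unfolding QuadRes_def by (blast intro: cong_trans)
  qed
  with that show thesis
    by blast
qed

lemma sums_of_two_squares_mod_prime_3_mod_4:
  fixes p :: nat
  assumes p: "prime p" "p mod 4 = 3"
  shows "sums_of_two_squares_mod p"
  unfolding sums_of_two_squares_mod_def
proof
  fix z :: int
  have "2 < p"
    using p(2) prime_ge_2_nat[OF p(1)] by (cases "p = 2") auto
  show "\<exists>x y :: int. [x\<^sup>2 + y\<^sup>2 = z] (mod int p)"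
  proof (cases "QuadRes p z")
    case True
    then obtain y where "[y\<^sup>2 + 0\<^sup>2 = z] (mod int p)"
      unfolding QuadRes_def by auto
    then show ?thesis
      by blast
  next
    case False
    obtain s where s: "\<not> QuadRes p (s\<^sup>2 + 1)"
      using exists_nonresidue_square_plus_one[OF p] .
    from QuadRes_mult_nonresidues[OF p(1) \<open>2 < p\<close> False s]
    obtain w where w: "int p dvd w\<^sup>2 - z * (s\<^sup>2 + 1)"
      unfolding QuadRes_def cong_iff_dvd_diff by blast
    have "\<not> int p dvd s\<^sup>2 + 1"
      using prime_dvd_sum_of_squares[OF p, of 1 s] p(1) by (auto simp: add.commute)
    then obtain u where "[(s\<^sup>2 + 1) * u = 1] (mod int p)"
      using cong_solve_coprime_int coprime_prime_int p(1) by blast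
    then have "int p dvd (s\<^sup>2 + 1) * u - 1"
      by (simp add: cong_iff_dvd_diff)
    \<comment> \<open>Here u inverts s^2 + 1, so z is w^2 * u * (s^2 + 1) * u, a square times s^2 +
      1. The second summand equals z * (((s^2 + 1) * u)^2 - 1) and cancels the unwanted term of the
      first, leaving -z.\<close>
    then have "int p dvd (w\<^sup>2 - z * (s\<^sup>2 + 1)) * (u\<^sup>2 * (s\<^sup>2 + 1))
        + ((s\<^sup>2 + 1) * u - 1) * (z * ((s\<^sup>2 + 1) * u + 1))"
      using w by (meson dvd_add dvd_mult2)
    also have "\<dots> = (w * u * s)\<^sup>2 + (w * u)\<^sup>2 - z"
      by (simp add: power2_eq_square algebra_simps)
    finally show ?thesis
      unfolding cong_iff_dvd_diff by blast
  qed
qed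

section \<open>Primes congruent to 1 modulo 4\<close>

text \<open>Hensel lifting of a root of X^2 + 1: the derivative 2 * i is invertible modulo p. The
  exponent \<open>Suc k\<close> starts the induction at p itself.\<close>

lemma sqrt_minus_one_mod_prime_power:
  fixes p k :: nat
  assumes p: "prime p" "p mod 4 = 1"
  shows "\<exists>i :: int. int p ^ Suc k dvd i\<^sup>2 + 1"
proof (induction k)
  case 0
  have "2 < p"
    using p(2) prime_ge_2_nat[OF p(1)] by (cases "p = 2") auto
  then have "QuadRes p (-1)"
    using QuadRes_minus_one_iff p by simp
  then show ?case
    by (simp add: QuadRes_def cong_iff_dvd_diff)
next
  case (Suc k)
  then obtain i c where c: "i\<^sup>2 + 1 = int p ^ Suc k * c"
    by (auto elim: dvdE)
  have "\<not> int p dvd 2"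
    using p zdvd_imp_le[of "int p" 2] prime_ge_2_nat[OF p(1)] by (cases "p = 2") auto
  moreover have "\<not> int p dvd i"
  proof
    assume "int p dvd i"
    then have "int p dvd int p ^ Suc k * c - i\<^sup>2"
      by (simp add: power2_eq_square)
    also have "int p ^ Suc k * c - i\<^sup>2 = 1"
      using c by linarith
    finally have "int p dvd 1" .
    then show False
      using p(1) by auto
  qed
  ultimately have "\<not> int p dvd 2 * i"
    using p(1) by (simp add: prime_dvd_mult_iff)
  then obtain u where u: "int p dvd 2 * i * u - 1"
    using cong_solve_coprime_int coprime_prime_int p(1) unfolding cong_iff_dvd_diff by blast
  \<comment> \<open>Dividing (i + t * p^(k+1))^2 + 1 by p^(k+1) leaves c + 2 * i * t + t^2 *
    p^(k+1). As u inverts 2 * i, this t makes c + 2 * i * t vanish modulo p.\<close>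
  define t where "t = - (c * u)"
  have "c + 2 * i * t = (2 * i * u - 1) * (- c)"
    by (simp add: t_def algebra_simps)
  then have "int p dvd c + 2 * i * t"
    using u by (metis dvd_mult2)
  moreover have "int p dvd t\<^sup>2 * int p ^ Suc k"
    by simp
  ultimately have "int p dvd (c + 2 * i * t) + t\<^sup>2 * int p ^ Suc k"
    by (rule dvd_add)
  then have "int p ^ Suc k * int p dvd int p ^ Suc k * ((c + 2 * i * t) + t\<^sup>2 * int p ^ Suc k)"
    by (rule mult_dvd_mono[OF dvd_refl])
  also have "\<dots> = (i\<^sup>2 + 1) + 2 * i * (t * int p ^ Suc k) + (t * int p ^ Suc k)\<^sup>2"
    unfolding c by (simp add: power2_eq_square algebra_simps)
  also have "\<dots> = (i + t * int p ^ Suc k)\<^sup>2 + 1"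
    by (simp add: power2_sum)
  finally have "int p ^ Suc (Suc k) dvd (i + t * int p ^ Suc k)\<^sup>2 + 1"
    by (simp add: mult_ac)
  then show ?case
    by blast
qed

lemma sums_of_two_squares_mod_if_sqrt_minus_one:
  fixes n i :: int
  assumes n: "odd n" and i: "n dvd i\<^sup>2 + 1"
  shows "sums_of_two_squares_mod n"
  unfolding sums_of_two_squares_mod_def
proof
  fix z :: int
  obtain h where h: "n dvd 2 * h - 1"
    using cong_solve_coprime_int[of 2 n] n unfolding cong_iff_dvd_diff by auto
  \<comment> \<open>With h the inverse of 2, the second summand is 4 * h^2 * z - z, and h^2 * (z -
    1)^2 + 4 * h^2 * z = h^2 * (z + 1)^2. The factor i turns the difference of squares into a
    sum.\<close>
  have "n dvd (i\<^sup>2 + 1) * (h * (z - 1))\<^sup>2 + (2 * h - 1) * ((2 * h + 1) * z)"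
    using i h by (meson dvd_add dvd_mult2)
  also have "\<dots> = (h * (z + 1))\<^sup>2 + (i * (h * (z - 1)))\<^sup>2 - z"
    by (simp add: power2_eq_square algebra_simps)
  finally show "\<exists>x y :: int. [x\<^sup>2 + y\<^sup>2 = z] (mod n)"
    unfolding cong_iff_dvd_diff by blast
qed

section \<open>Assembling the modulus from prime powers\<close>

lemma sums_of_two_squares_mod_2: "sums_of_two_squares_mod 2"
  unfolding sums_of_two_squares_mod_def
proof
  fix z :: int
  have "[z\<^sup>2 + 0\<^sup>2 = z] (mod 2)"
    by (simp add: cong_iff_dvd_diff)
  then show "\<exists>x y :: int. [x\<^sup>2 + y\<^sup>2 = z] (mod 2)"
    by blast
qed

lemma sums_of_two_squares_mod_mult:
  fixes a b :: int
  assumes co: "coprime a b" and a: "sums_of_two_squares_mod a" and b: "sums_of_two_squares_mod b"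
  shows "sums_of_two_squares_mod (a * b)"
  unfolding sums_of_two_squares_mod_def
proof
  fix z :: int
  obtain x1 y1 where 1: "[x1\<^sup>2 + y1\<^sup>2 = z] (mod a)"
    using a unfolding sums_of_two_squares_mod_def by blast
  obtain x2 y2 where 2: "[x2\<^sup>2 + y2\<^sup>2 = z] (mod b)"
    using b unfolding sums_of_two_squares_mod_def by blast
  obtain x where x: "[x = x1] (mod a)" "[x = x2] (mod b)"
    using binary_chinese_remainder_int[OF co] by blast
  obtain y where y: "[y = y1] (mod a)" "[y = y2] (mod b)"
    using binary_chinese_remainder_int[OF co] by blast
  have "[x\<^sup>2 + y\<^sup>2 = z] (mod a)"
    using cong_trans[OF cong_add[OF cong_pow[OF x(1)] cong_pow[OF y(1)]] 1] .
  moreover have "[x\<^sup>2 + y\<^sup>2 = z] (mod b)"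
    using cong_trans[OF cong_add[OF cong_pow[OF x(2)] cong_pow[OF y(2)]] 2] .
  ultimately have "[x\<^sup>2 + y\<^sup>2 = z] (mod a * b)"
    using co by (simp add: cong_iff_dvd_diff divides_mult)
  then show "\<exists>x y :: int. [x\<^sup>2 + y\<^sup>2 = z] (mod a * b)"
    by blast
qed

text \<open>The assumptions \<open>two\<close> and \<open>three\<close> allow only the first power
  of 2 and of primes that are 3 modulo 4; higher powers are reached only through a square root of
  -1.\<close>

lemma sums_of_two_squares_mod_prime_power:
  fixes p k :: nat
  assumes p: "prime p" and two: "p = 2 \<Longrightarrow> k = 0" and three: "p mod 4 = 3 \<Longrightarrow> k = 0"
  shows "sums_of_two_squares_mod (int p ^ Suc k)"
proof -
  consider "p = 2" | "p mod 4 = 1" | "p mod 4 = 3"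
  proof -
    have "p = 2 \<or> odd p"
      using p prime_odd_nat prime_ge_2_nat by (metis le_neq_implies_less)
    then have "p = 2 \<or> p mod 4 = 1 \<or> p mod 4 = 3"
      by presburger
    with that show thesis
      by blast
  qed
  then show ?thesis
  proof cases
    case 1
    with two show ?thesis
      by (simp add: sums_of_two_squares_mod_2)
  next
    case 2
    then have "odd (int p ^ Suc k)"
      by simp presburger
    with 2 p show ?thesis
      using sqrt_minus_one_mod_prime_power sums_of_two_squares_mod_if_sqrt_minus_one by blast
  next
    case 3
    with three p show ?thesis
      by (simp add: sums_of_two_squares_mod_prime_3_mod_4)
  qed
qed

text \<open>Strong induction: split off the full power of one prime p. The cofactor m is coprime to
  p, and as a divisor of n it inherits the two divisibility conditions.\<close>

lemma sums_of_two_squares_modI: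
  fixes n :: nat
  assumes "n > 0" "\<not> 4 dvd n" "\<And>p. prime p \<Longrightarrow> p mod 4 = 3 \<Longrightarrow> \<not> p\<^sup>2 dvd n"
  shows "sums_of_two_squares_mod n"
  using assms
proof (induction n rule: less_induct)
  case (less n)
  show ?case
  proof (cases "n = 1")
    case True
    then show ?thesis
      by (simp add: sums_of_two_squares_mod_def)
  next
    case False
    then obtain p where p: "prime p" "p dvd n"
      using prime_factor_nat by blast
    obtain m where m: "n = p ^ multiplicity p n * m" "\<not> p dvd m"
      using multiplicity_decompose'[of n p] less.prems(1) p(1) by (metis neq0_conv not_prime_unit)
    have "multiplicity p n > 0"
      using p less.prems(1) by (simp add: prime_multiplicity_gt_zero_iff)
    then obtain k where k: "n = p ^ Suc k * m"
      using m(1) by (metis gr0_conv_Suc)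
    have "m dvd n"
      using k by simp
    have "m > 0"
      using k less.prems(1) by (cases "m = 0") auto
    have "p ^ Suc k > 1"
      using p(1) prime_gt_1_nat one_less_power by blast
    then have "m < n"
      using k \<open>m > 0\<close> by simp
    then have "sums_of_two_squares_mod m"
      using less.IH less.prems \<open>m > 0\<close> \<open>m dvd n\<close> dvd_trans by blast
    moreover have "sums_of_two_squares_mod (int p ^ Suc k)"
    proof (rule sums_of_two_squares_mod_prime_power[OF p(1)])
      have sq: "p\<^sup>2 dvd n" if "k \<noteq> 0"
        using that k by (cases k) (auto simp: power2_eq_square)
      show "k = 0" if "p = 2"
        using sq less.prems(2) that by auto
      show "k = 0" if "p mod 4 = 3"
        using sq less.prems(3) p(1) that by blast
    qed
    moreover have "coprime (int p ^ Suc k) (int m)"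
      using p(1) m(2) prime_imp_coprime by (simp add: prime_imp_coprime)
    ultimately show ?thesis
      using sums_of_two_squares_mod_mult k by fastforce
  qed
qed

section \<open>Obstructions modulo 4 and modulo squares of primes\<close>

lemma sum_of_two_squares_mod_4: "\<not> [x\<^sup>2 + y\<^sup>2 = 3] (mod 4)" for x y :: int
proof -
  have sq: "a\<^sup>2 mod 4 = 0 \<or> a\<^sup>2 mod 4 = 1" for a :: int
  proof (cases "even a")
    case True
    then show ?thesis
      by (auto elim!: evenE simp: power2_eq_square)
  next
    case False
    then obtain b where "a = 2 * b + 1"
      by (rule oddE)
    then have "a\<^sup>2 = 4 * (b\<^sup>2 + b) + 1"
      by (simp add: power2_eq_square algebra_simps)
    then show ?thesis
      by presburger
  qed
  show ?thesis
    using sq[of x] sq[of y] unfolding cong_def by presburger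
qed

text \<open>A representation would make q divide x^2 + y^2, hence both x and y. Then q^2 divides x^2
  + y^2 and therefore q.\<close>

lemma sum_of_two_squares_mod_prime_square:
  fixes q :: nat and x y :: int
  assumes q: "prime q" "q mod 4 = 3"
  shows "\<not> [x\<^sup>2 + y\<^sup>2 = int q] (mod (int q)\<^sup>2)"
proof
  assume "[x\<^sup>2 + y\<^sup>2 = int q] (mod (int q)\<^sup>2)"
  then have d: "(int q)\<^sup>2 dvd x\<^sup>2 + y\<^sup>2 - int q"
    by (simp add: cong_iff_dvd_diff)
  have "int q dvd (x\<^sup>2 + y\<^sup>2 - int q) + int q"
    using d by (intro dvd_add) (auto intro: dvd_trans[of _ "(int q)\<^sup>2"])
  then have "int q dvd x\<^sup>2 + y\<^sup>2"
    by simp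
  then have "int q dvd x" "int q dvd y"
    using prime_dvd_sum_of_squares[OF q, of x y] prime_dvd_sum_of_squares[OF q, of y x]
    by (simp_all add: add.commute)
  then have "(int q)\<^sup>2 dvd (x\<^sup>2 + y\<^sup>2) - (x\<^sup>2 + y\<^sup>2 - int q)"
    by (intro dvd_diff[OF _ d] dvd_add dvd_power_same)
  also have "\<dots> = int q"
    by simp
  finally have "(int q)\<^sup>2 dvd int q" .
  then have "(int q)\<^sup>2 \<le> int q"
    using prime_gt_0_nat[OF q(1)] by (intro zdvd_imp_le) simp_all
  then show False
    using prime_gt_1_nat[OF q(1)] by (simp add: power2_eq_square)
qed

theorem theorem4p1:
  fixes n :: int
  assumes "n \<ge> 2"
  shows "(\<forall>z \<in> carrier (residue_ring n). \<exists>x y :: int. [x\<^sup>2 + y\<^sup>2 = z] (mod n)) \<longleftrightarrow>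
    (\<forall>q :: int. prime q \<and> [q = 3] (mod 4) \<and> [n = 0] (mod q) \<longrightarrow> \<not> [n = 0] (mod q\<^sup>2)) \<and>
    \<not> [n = 0] (mod 4)"
    (is "?L \<longleftrightarrow> ?R")
proof
  assume ?L
  \<comment> \<open>A representation modulo n persists modulo every divisor of n, and any integer z
    may be replaced by \<open>z mod n\<close>. The obstructions at 4 and at q^2 can thus be applied
    to divisors of n.\<close>
  have rep: "\<exists>x y :: int. [x\<^sup>2 + y\<^sup>2 = z] (mod m)" if "m dvd n" for z m
  proof -
    have "z mod n \<in> carrier (residue_ring n)"
      using assms by (simp add: residue_ring_def)
    then obtain x y :: int where "[x\<^sup>2 + y\<^sup>2 = z mod n] (mod n)"
      using \<open>?L\<close> by blast
    then have "[x\<^sup>2 + y\<^sup>2 = z] (mod n)"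
      by (simp add: cong_def)
    then show ?thesis
      using that cong_dvd_modulus by blast
  qed
  show ?R
  proof (intro conjI allI impI notI)
    assume "[n = 0] (mod 4)"
    then show False
      using rep[of 4 3] sum_of_two_squares_mod_4 by (auto simp: cong_0_iff)
  next
    fix q :: int
    assume q: "prime q \<and> [q = 3] (mod 4) \<and> [n = 0] (mod q)" and sq: "[n = 0] (mod q\<^sup>2)"
    define r where "r = nat q"
    have r: "q = int r"
      using q by (simp add: r_def prime_ge_0_int)
    have "prime r"
      using q r by simp
    moreover have "r mod 4 = 3"
    proof -
      have "int r mod 4 = 3"
        using q r by (simp add: cong_def)
      then show ?thesis
        by presburger
    qed
    ultimately show False
      using rep[of "q\<^sup>2" q] sq sum_of_two_squares_mod_prime_square r by (auto simp: cong_0_iff)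
  qed
next
  assume R: ?R
  define m where "m = nat n"
  have m: "n = int m"
    using assms by (simp add: m_def)
  have "sums_of_two_squares_mod m"
  proof (rule sums_of_two_squares_modI)
    show "m > 0"
      using assms m by simp
    show "\<not> 4 dvd m"
      using R m by (auto simp: cong_0_iff)
    fix p :: nat
    assume p: "prime p" "p mod 4 = 3"
    have "[int p = 3] (mod 4)"
      using arg_cong[OF p(2), of int] by (simp add: cong_def zmod_int)
    moreover have "prime (int p)"
      using p(1) by simp
    ultimately have "\<not> (int p)\<^sup>2 dvd int m" if "int p dvd int m"
      using R m that by (auto simp: cong_0_iff)
    \<comment> \<open>Condition (1) presupposes that the prime divides n; this follows once its
      square does.\<close>
    moreover have "int p dvd int m" if "p\<^sup>2 dvd m"
      using that by (metis dvd_mult_left int_dvd_int_iff power2_eq_square)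
    moreover have "(int p)\<^sup>2 dvd int m \<longleftrightarrow> p\<^sup>2 dvd m"
      by (metis int_dvd_int_iff of_nat_power)
    ultimately show "\<not> p\<^sup>2 dvd m"
      by blast
  qed
  then show ?L
    unfolding sums_of_two_squares_mod_def m by blast
qed

end
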